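(* There is an absolute constant $c>0$ such that for every Boolean function $f$ and every Boolean formula $F$ over $\{\land_2,\lor_2,\lnot\}$ computing $f$, $\mathsf{EC^F}(F)\ge c\left(\sqrt{L(F)}-\mathrm{depth}(F)\right)$; that is, $\mathsf{EC^F}(F)=\Omega\left(\sqrt{L(F)}-\mathrm{depth}(F)\right)$.
   Context: A Boolean formula $F$ over $\{\land_2,\lor_2,\lnot\}$ (AND and OR of fan-in 2, and NOT) is a Boolean circuit whose underlying graph is a tree: leaves are labeled by variables $x_1,\dots,x_n$ (a variable may label several leaves), internal nodes (including the root) are labeled by functions in the basis. $L(F)$ is the number of leaves of $F$ and $\mathrm{depth}(F)$ is the length of the longest path from the root to any leaf. $\mathsf{EC^F}(F)$ is the maximum over all inputs $a\in\{0,1\}^n$ of the number of non-input gates (internal nodes) of $F$ that output $1$ on $a$. *)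

theory Defs
  imports Complex_Main "HOL-Library.FuncSet"
begin

text \<open>Tree-shaped circuits with NOT and fan-in-2 AND and OR; every occurrence of a gate or of
  a leaf is a separate node.\<close>

datatype bformula =
    is_Leaf: Leaf nat
  | NotG bformula
  | AndG bformula bformula
  | OrG bformula bformula

primrec vars :: "bformula \<Rightarrow> nat set" where
  "vars (Leaf i) = {i}"
| "vars (NotG F) = vars F"
| "vars (AndG F G) = vars F \<union> vars G"
| "vars (OrG F G) = vars F \<union> vars G"

text \<open>The root of a formula is an internal node, so a lone leaf does not count as a formula.
  This matters for the lower bound: a lone leaf has one leaf, depth 0 and no gates.\<close>

definition formula_over :: "nat \<Rightarrow> bformula \<Rightarrow> bool" where
  "formula_over n F \<longleftrightarrow> vars F \<subseteq> {1..n} \<and> \<not> is_Leaf F"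

text \<open>The cube $\{0,1\}^n$, with coordinates indexed by $1,\dots,n$.\<close>

definition cube :: "nat \<Rightarrow> (nat \<Rightarrow> bool) set" where
  "cube n = {1..n} \<rightarrow>\<^sub>E UNIV"

primrec eval_formula :: "bformula \<Rightarrow> (nat \<Rightarrow> bool) \<Rightarrow> bool" where
  "eval_formula (Leaf i) a = a i"
| "eval_formula (NotG F) a = (\<not> eval_formula F a)"
| "eval_formula (AndG F G) a = (eval_formula F a \<and> eval_formula G a)"
| "eval_formula (OrG F G) a = (eval_formula F a \<or> eval_formula G a)"

definition computes :: "nat \<Rightarrow> bformula \<Rightarrow> ((nat \<Rightarrow> bool) \<Rightarrow> bool) \<Rightarrow> bool" where
  "computes n F f \<longleftrightarrow> (\<forall>a\<in>cube n. eval_formula F a = f a)"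

primrec leaves :: "bformula \<Rightarrow> nat" where
  "leaves (Leaf i) = 1"
| "leaves (NotG F) = leaves F"
| "leaves (AndG F G) = leaves F + leaves G"
| "leaves (OrG F G) = leaves F + leaves G"

text \<open>Path length is the number of edges; NOT gates contribute.\<close>

primrec depth :: "bformula \<Rightarrow> nat" where
  "depth (Leaf i) = 0"
| "depth (NotG F) = Suc (depth F)"
| "depth (AndG F G) = Suc (max (depth F) (depth G))"
| "depth (OrG F G) = Suc (max (depth F) (depth G))"

text \<open>The number of gates, NOT gates included and leaves excluded, that output 1 on \<open>a\<close>.\<close>

primrec active_gates :: "bformula \<Rightarrow> (nat \<Rightarrow> bool) \<Rightarrow> nat" where
  "active_gates (Leaf i) a = 0"
| "active_gates (NotG F) a = of_bool (eval_formula (NotG F) a) + active_gates F a"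
| "active_gates (AndG F G) a =
     of_bool (eval_formula (AndG F G) a) + active_gates F a + active_gates G a"
| "active_gates (OrG F G) a =
     of_bool (eval_formula (OrG F G) a) + active_gates F a + active_gates G a"

definition energy_complexity :: "nat \<Rightarrow> bformula \<Rightarrow> nat" where
  "energy_complexity n F = Max (active_gates F ` cube n)"

end

theory Submission
  imports Defs
begin

text \<open>A formula of depth \<open>d\<close> in which \<open>B\<close> gates have only leaves as children has at most
  \<open>B * d + 1\<close> leaves. Each such bottom gate outputs 1 on the all-ones input (AND, OR) or on the
  all-zeros input (NOT), so \<open>B\<close> is at most twice the energy \<open>E\<close> and the number \<open>L\<close> of leaves is
  at most \<open>4 * E * d\<close>. The induction is carried out directly with the total number of active
  gates on these two inputs in place of \<open>B\<close>. If \<open>d \<le> sqrt L\<close>, this gives \<open>E \<ge> sqrt L / 4\<close>; otherwise the bound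
  is trivial.\<close>

lemma depth_pos: "\<not> is_Leaf F \<Longrightarrow> depth F \<ge> 1"
  by (cases F) auto

lemma leaves_pos: "leaves F \<ge> 1"
  by (induction F) auto

text \<open>Descending through children that are gates ends at a gate fed only by leaves: AND or OR
  outputs 1 on \<open>a\<close>, NOT outputs 1 on \<open>b\<close>.\<close>

lemma active_gates_constant_inputs_pos:
  assumes "\<not> is_Leaf F" "\<forall>i\<in>vars F. a i" "\<forall>i\<in>vars F. \<not> b i"
  shows "active_gates F a + active_gates F b \<ge> 1"
  using assms
proof (induction F)
  case (NotG F)
  then show ?case by (cases "is_Leaf F") (auto simp: is_Leaf_def)
next
  case (AndG F G)
  then show ?case by (cases "is_Leaf F"; cases "is_Leaf G") (auto simp: is_Leaf_def)
next
  case (OrG F G)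
  then show ?case by (cases "is_Leaf F"; cases "is_Leaf G") (auto simp: is_Leaf_def)
qed simp

text \<open>Induction step at a binary gate: \<open>s\<close> and \<open>t\<close> count active
  gates in the children, \<open>u\<close> at the gate itself. The two bounds add up to a surplus of
  2; the new level of depth adds \<open>s + t + u\<close>, which is at least 1 and absorbs one of
  them.\<close>

lemma leaves_le_of_binary:
  fixes l m d e s t u :: nat
  assumes "l \<le> s * d + 1" "m \<le> t * e + 1" "s + t + u \<ge> 1"
  shows "l + m \<le> (s + t + u) * Suc (max d e) + 1"
proof -
  have "s * d \<le> s * max d e" "t * e \<le> t * max d e"
    by simp_all
  then have "l + m \<le> (s + t) * max d e + 2"
    using assms unfolding add_mult_distrib by linarith
  also have "\<dots> \<le> (s + t + u) * max d e + (s + t + u) + 1"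
  proof -
    have "(s + t) * max d e \<le> (s + t + u) * max d e"
      by (intro mult_right_mono) auto
    then show ?thesis
      using assms(3) by linarith
  qed
  finally show ?thesis by simp
qed

text \<open>The additive 1 is what a lone leaf requires. A NOT gate keeps the leaf count and
  decreases neither factor.\<close>

lemma leaves_le_active_gates_mult_depth:
  assumes "\<forall>i\<in>vars F. a i" "\<forall>i\<in>vars F. \<not> b i"
  shows "leaves F \<le> (active_gates F a + active_gates F b) * depth F + 1"
  using assms
proof (induction F)
  case (NotG F)
  then have "leaves F \<le> (active_gates F a + active_gates F b) * depth F + 1"
    by simp
  also have "\<dots> \<le> (active_gates (NotG F) a + active_gates (NotG F) b) * depth (NotG F) + 1"
    by (intro add_mono mult_mono) auto
  finally show ?case by simp
next
  case (AndG F G)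
  let ?u = "of_bool (eval_formula (AndG F G) a) + of_bool (eval_formula (AndG F G) b) :: nat"
  have "leaves F + leaves G \<le> ((active_gates F a + active_gates F b)
      + (active_gates G a + active_gates G b) + ?u) * Suc (max (depth F) (depth G)) + 1"
    using AndG active_gates_constant_inputs_pos[of "AndG F G" a b]
    by (intro leaves_le_of_binary) (auto simp del: eval_formula.simps)
  then show ?case by (simp add: ac_simps)
next
  case (OrG F G)
  let ?u = "of_bool (eval_formula (OrG F G) a) + of_bool (eval_formula (OrG F G) b) :: nat"
  have "leaves F + leaves G \<le> ((active_gates F a + active_gates F b)
      + (active_gates G a + active_gates G b) + ?u) * Suc (max (depth F) (depth G)) + 1"
    using OrG active_gates_constant_inputs_pos[of "OrG F G" a b]
    by (intro leaves_le_of_binary) (auto simp del: eval_formula.simps)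
  then show ?case by (simp add: ac_simps)
qed simp

lemma active_gates_le_energy_complexity:
  assumes "a \<in> cube n"
  shows "active_gates F a \<le> energy_complexity n F"
proof -
  have "finite (cube n)"
    unfolding cube_def by (intro finite_PiE) auto
  then show ?thesis
    unfolding energy_complexity_def using assms by (intro Max_ge) auto
qed

lemma leaves_le_energy_complexity_mult_depth:
  assumes "formula_over n F"
  shows "leaves F \<le> 4 * energy_complexity n F * depth F"
proof -
  \<comment> \<open>Points of \<open>cube n\<close> are extensional, so the constant inputs are
    restricted to \<open>{1..n}\<close>.\<close>
  define a b :: "nat \<Rightarrow> bool"
    where "a = restrict (\<lambda>_. True) {1..n}" and "b = restrict (\<lambda>_. False) {1..n}"
  define s where "s = active_gates F a + active_gates F b"
  have F: "vars F \<subseteq> {1..n}" "\<not> is_Leaf F"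
    using assms by (auto simp: formula_over_def)
  have "a \<in> cube n" "b \<in> cube n"
    by (auto simp: a_def b_def cube_def)
  then have "s \<le> 2 * energy_complexity n F"
    using active_gates_le_energy_complexity[of a n F] active_gates_le_energy_complexity[of b n F]
    by (simp add: s_def)
  have ab: "\<forall>i\<in>vars F. a i" "\<forall>i\<in>vars F. \<not> b i"
    using F by (auto simp: a_def b_def)
  \<comment> \<open>Since the root is a gate, the additive 1 is at most this product, at the cost of
    a factor 2.\<close>
  have "s * depth F \<ge> 1"
    using active_gates_constant_inputs_pos[OF F(2) ab] depth_pos[OF F(2)] by (simp add: s_def)
  then have "leaves F \<le> 2 * (s * depth F)"
    using leaves_le_active_gates_mult_depth[OF ab] unfolding s_def by linarith
  also have "\<dots> \<le> 2 * (2 * energy_complexity n F * depth F)"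
    using \<open>s \<le> _\<close> by (intro mult_left_mono mult_right_mono) auto
  finally show ?thesis by simp
qed

theorem theorem1p5:
  "\<exists>c::real. c > 0 \<and>
     (\<forall>(n::nat) (f :: (nat \<Rightarrow> bool) \<Rightarrow> bool) (F :: bformula).
        formula_over n F \<longrightarrow> computes n F f \<longrightarrow>
        real (energy_complexity n F) \<ge> c * (sqrt (real (leaves F)) - real (depth F)))"
\<comment> \<open>The 4 is 2 for the absorbed additive 1 times 2 for the two inputs.\<close>
proof (intro exI[of _ "1/4"] conjI allI impI)
  fix n :: nat and f :: "(nat \<Rightarrow> bool) \<Rightarrow> bool" and F :: bformula
  assume F: "formula_over n F"
  define r where "r = sqrt (real (leaves F))"
  define E where "E = real (energy_complexity n F)"
  have "r > 0"
    using leaves_pos[of F] by (simp add: r_def)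
  have "1/4 * (r - real (depth F)) \<le> E"
  proof (cases "real (depth F) \<le> r")
    case True
    have "r * r = real (leaves F)"
      by (simp add: r_def)
    also have "\<dots> \<le> real (4 * energy_complexity n F * depth F)"
      using leaves_le_energy_complexity_mult_depth[OF F] by (rule of_nat_mono)
    also have "\<dots> = 4 * E * real (depth F)"
      by (simp add: E_def)
    also have "\<dots> \<le> 4 * E * r"
      using True by (intro mult_left_mono) (auto simp: E_def)
    finally have "r \<le> 4 * E"
      using \<open>r > 0\<close> by simp
    then show ?thesis by simp
  next
    case False
    then show ?thesis
      by (smt (verit) E_def of_nat_0_le_iff mult_nonneg_nonpos zero_le_divide_1_iff)
  qed
  then show "1/4 * (sqrt (real (leaves F)) - real (depth F)) \<le> real (energy_complexity n F)"
    by (simp add: r_def E_def)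
qed simp

end
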